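(* Let $d\ge1$ and let $S\subseteq\mathbb{N}_0^d$ be a Frobenius generalized numerical semigroup with Frobenius element $\mathbf{f}$ and type $t$. Then the following statements are equivalent: (i) $S$ is almost symmetric; (ii) $\operatorname{L}(S)\subseteq \operatorname{PF}(S)$; (iii) $\operatorname{PF}(S)=\operatorname{L}(S)\cup \{\mathbf{f}\}$; (iv) if $\mathbf{h}\in \operatorname{Z}_{S}\setminus S$ then either $\mathbf{f}-\mathbf{h}\in S$ or $\mathbf{f}-\mathbf{h}\in \operatorname{PF}(S)$; (v) if $\mathbf{h}\in \operatorname{H}(S)$ then either $\mathbf{f}-\mathbf{h}\in S$ or $\mathbf{f}-\mathbf{h}\in \operatorname{PF}(S)$; (vi) for every monomial order $\prec$ in $\mathbb{N}_0^{d}$, if $\operatorname{PF}(S)\setminus \{\mathbf{f}\}=\{\mathbf{x}_{1}\prec \mathbf{x}_{2}\prec \cdots \prec \mathbf{x}_{t-1}\}$, then $\mathbf{x}_{i}+\mathbf{x}_{t-i}=\mathbf{f}$ for $i=1,\ldots,t-1$; (vii) there exists a monomial order $\prec$ in $\mathbb{N}_0^{d}$ such that, if $\operatorname{PF}(S)\setminus \{\mathbf{f}\}=\{\mathbf{x}_{1}\prec \mathbf{x}_{2}\prec \cdots \prec \mathbf{x}_{t-1}\}$, then $\mathbf{x}_{i}+\mathbf{x}_{t-i}=\mathbf{f}$ for $i=1,\ldots,t-1$.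
   Context: $\mathbb{N}_0$ is the set of nonnegative integers. A generalized numerical semigroup (GNS) is a submonoid $S$ of $(\mathbb{N}_0^d,+)$ (closed under addition, containing $\mathbf{0}$) whose complement $\operatorname{H}(S)=\mathbb{N}_0^d\setminus S$ (the set of gaps) is finite. Its genus is $\operatorname{g}(S)=|\operatorname{H}(S)|$. Put $S^*=S\setminus\{\mathbf{0}\}$. The set of pseudo-Frobenius elements is $\operatorname{PF}(S)=\{\mathbf{h}\in\operatorname{H}(S)\mid \mathbf{h}+\mathbf{s}\in S\text{ for all }\mathbf{s}\in S^*\}$, and the type of $S$ is $\operatorname{t}(S)=|\operatorname{PF}(S)|$. For $\mathbf{x}=(x^{(1)},\dots,x^{(d)})\in\mathbb{N}_0^d$, $|\mathbf{x}|_\times=x^{(1)}\cdots x^{(d)}$, and $\mathbf{x}+\mathbf{1}$ is the vector with components $x^{(i)}+1$. The symbol $\le$ denotes the componentwise partial order on $\mathbb{Z}^d$. $S$ is a Frobenius GNS if $\operatorname{H}(S)$ has a unique maximal element with respect to $\le$; this element is called the Frobenius element of $S$. $S$ is almost symmetric if $2\operatorname{g}(S)+1-\operatorname{t}(S)=|\mathbf{h}+\mathbf{1}|_\times$ for some $\mathbf{h}\in\operatorname{H}(S)$. For a Frobenius GNS $S$ with Frobenius element $\mathbf{f}$: $\operatorname{Z}_{S}=\{\mathbf{x}\in \mathbb{Z}^d \mid \mathbf{x}\leq \mathbf{f}\}\cup \mathbb{N}_0^d$ and $\operatorname{L}(S)=\{\mathbf{h}\in \operatorname{H}(S) \mid \exists\,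 \mathbf{h}'\in \operatorname{H}(S),\ \mathbf{h}+\mathbf{h}'=\mathbf{f}\}$. Differences are taken in $\mathbb{Z}^d$. A monomial order on $\mathbb{N}_0^d$ is a (strict) total order $\prec$ such that $\mathbf{v}\prec\mathbf{w}$ implies $\mathbf{v}+\mathbf{u}\prec\mathbf{w}+\mathbf{u}$ for every $\mathbf{u}\in\mathbb{N}_0^d$, and $\mathbf{0}\prec\mathbf{v}$ for every $\mathbf{v}\neq\mathbf{0}$. The notation $\{\mathbf{x}_1\prec\cdots\prec\mathbf{x}_{t-1}\}$ means the set listed in increasing order. *)

theory Defs
  imports "HOL-Analysis.Finite_Cartesian_Product"
begin

text \<open>
  Elements of \<open>\<nat>\<^sub>0\<^sup>d\<close> are vectors of type \<open>nat ^ 'd\<close>, and \<open>d = CARD('d)\<close> is an arbitrary positive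
  integer. The library's order on vectors is the componentwise one, and the vector \<open>1\<close> has all
  components equal to \<open>1\<close>.
\<close>

definition gns :: "(nat ^ 'd) set \<Rightarrow> bool" where
  "gns S \<longleftrightarrow> 0 \<in> S \<and> (\<forall>x\<in>S. \<forall>y\<in>S. x + y \<in> S) \<and> finite (- S)"

definition gaps :: "(nat ^ 'd) set \<Rightarrow> (nat ^ 'd) set" where
  "gaps S = - S"

definition genus :: "(nat ^ 'd) set \<Rightarrow> nat" where
  "genus S = card (gaps S)"

definition pseudo_frobenius :: "(nat ^ 'd) set \<Rightarrow> (nat ^ 'd) set" where
  "pseudo_frobenius S = {h \<in> gaps S. \<forall>s \<in> S - {0}. h + s \<in> S}"

definition gns_type :: "(nat ^ 'd) set \<Rightarrow> nat" where
  "gns_type S = card (pseudo_frobenius S)"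

definition component_product :: "nat ^ 'd \<Rightarrow> nat" where
  "component_product x = (\<Prod>i\<in>UNIV. x $ i)"

definition is_maximal_in :: "'a::order set \<Rightarrow> 'a \<Rightarrow> bool" where
  "is_maximal_in A m \<longleftrightarrow> m \<in> A \<and> \<not> (\<exists>x\<in>A. m < x)"

definition frobenius_gns :: "(nat ^ 'd) set \<Rightarrow> bool" where
  "frobenius_gns S \<longleftrightarrow> gns S \<and> (\<exists>!m. is_maximal_in (gaps S) m)"

definition is_frobenius_element :: "(nat ^ 'd) set \<Rightarrow> nat ^ 'd \<Rightarrow> bool" where
  "is_frobenius_element S f \<longleftrightarrow> frobenius_gns S \<and> is_maximal_in (gaps S) f"

text \<open>The equation is stated over the integers to avoid truncated subtraction.\<close>

definition almost_symmetric :: "(nat ^ 'd) set \<Rightarrow> bool" where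
  "almost_symmetric S \<longleftrightarrow>
     (\<exists>h\<in>gaps S. 2 * int (genus S) + 1 - int (gns_type S) = int (component_product (h + 1)))"

text \<open>The inclusion of \<open>\<nat>\<^sub>0\<^sup>d\<close> into \<open>\<int>\<^sup>d\<close>, where differences are taken.\<close>

definition emb :: "nat ^ 'd \<Rightarrow> int ^ 'd" where
  "emb x = (\<chi> i. int (x $ i))"

definition Z_set :: "nat ^ 'd \<Rightarrow> (int ^ 'd) set" where
  "Z_set f = {x. x \<le> emb f} \<union> range emb"

definition L_set :: "(nat ^ 'd) set \<Rightarrow> nat ^ 'd \<Rightarrow> (nat ^ 'd) set" where
  "L_set S f = {h \<in> gaps S. \<exists>h'\<in>gaps S. h + h' = f}"

definition monomial_order :: "(nat ^ 'd \<Rightarrow> nat ^ 'd \<Rightarrow> bool) \<Rightarrow> bool" where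
  "monomial_order prec \<longleftrightarrow>
     irreflp prec \<and> transp prec \<and> totalp prec \<and>
     (\<forall>u v w. prec v w \<longrightarrow> prec (v + u) (w + u)) \<and>
     (\<forall>v. v \<noteq> 0 \<longrightarrow> prec 0 v)"

text \<open>\<open>A = {x 1 \<prec> \<dots> \<prec> x (t - 1)}\<close>; the values of \<open>x\<close> outside \<open>{1..<t}\<close> are irrelevant.\<close>

definition increasing_listing ::
    "('a \<Rightarrow> 'a \<Rightarrow> bool) \<Rightarrow> 'a set \<Rightarrow> nat \<Rightarrow> (nat \<Rightarrow> 'a) \<Rightarrow> bool" where
  "increasing_listing prec A t x \<longleftrightarrow>
     A = x ` {1..<t} \<and> (\<forall>i\<in>{1..<t}. \<forall>j\<in>{1..<t}. i < j \<longrightarrow> prec (x i) (x j))"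

end

theory Submission
  imports Defs "HOL-Library.FuncSet"
begin

text \<open>
  Write \<open>H\<close>, \<open>L\<close> and \<open>PF\<close> for \<open>gaps S\<close>, \<open>L_set S f\<close> and \<open>pseudo_frobenius S\<close>. Since \<open>f\<close> is the only
  maximal gap and \<open>H\<close> is finite, \<open>H\<close> lies in the box \<open>{x. x \<le> f}\<close>, which has \<open>|f + 1|\<^sub>\<times>\<close> points.
  The reflection \<open>x \<mapsto> f - x\<close> of the box sends every point of \<open>S\<close> to a gap, because \<open>f\<close> is not a
  sum of two elements of \<open>S\<close>, and the gaps not reached in this way are exactly the elements of \<open>L\<close>.
  Counting gives \<open>|f + 1|\<^sub>\<times> + |L| = 2 g\<close> (\<open>component_product_plus_card_L\<close>). The same argument shows
  \<open>PF - {f} \<subseteq> L\<close>, so \<open>t - 1 \<le> |L|\<close>, with equality iff \<open>L \<subseteq> PF\<close>. As \<open>|h + 1|\<^sub>\<times>\<close> is largest at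
  \<open>h = f\<close> among the gaps, almost symmetry says precisely that this equality holds; this settles
  (i), (ii) and (iii). Statements (iv) and (v) reformulate \<open>L \<subseteq> PF\<close> through the reflection; the
  points of \<open>Z_set f\<close> with a negative coordinate are harmless, since their reflections do not lie
  below \<open>f\<close> and hence belong to \<open>S\<close>.

  For the last two statements, both the listing condition and \<open>L \<subseteq> PF\<close> are equivalent to
  invariance of \<open>PF - {f}\<close> under the reflection. Any monomial order is reversed by the reflection,
  so in a reflection-invariant set the \<open>i\<close>-th smallest element is exchanged with the \<open>i\<close>-th
  largest (\<open>increasing_listing_antipodal\<close>). Conversely, let \<open>PF - {f}\<close> be invariant and \<open>h \<in> L\<close>.
  Some \<open>s \<in> S\<close> has \<open>h + s \<in> PF\<close>, and \<open>f - h = (f - (h + s)) + s\<close> is a gap although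
  \<open>f - (h + s)\<close> is pseudo-Frobenius; hence \<open>s = 0\<close> and \<open>h \<in> PF\<close>. Lexicographic orders provide the
  monomial order needed in (vii).
\<close>

section \<open>Monomial orders and increasing listings\<close>

text \<open>The index type carries no order of its own, so the coordinates are compared in the order given
  by an arbitrary injection into the natural numbers.\<close>

lemma monomial_order_exists: "\<exists>prec :: nat ^ 'd \<Rightarrow> nat ^ 'd \<Rightarrow> bool. monomial_order prec"
proof -
  obtain e :: "'d \<Rightarrow> nat" where e: "inj e"
    using finite_imp_inj_to_nat_seg[of "UNIV :: 'd set"] by auto
  define lex :: "nat ^ 'd \<Rightarrow> nat ^ 'd \<Rightarrow> bool" where
    "lex v w \<longleftrightarrow> (\<exists>k. v $ k < w $ k \<and> (\<forall>j. e j < e k \<longrightarrow> v $ j = w $ j))" for v w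
  have total: "lex v w \<or> lex w v" if "v \<noteq> w" for v w
  proof -
    have "\<exists>k. v $ k \<noteq> w $ k"
      using that by (auto simp: vec_eq_iff)
    then obtain k where k: "v $ k \<noteq> w $ k" "\<And>j. v $ j \<noteq> w $ j \<Longrightarrow> e k \<le> e j"
      using ex_has_least_nat[of "\<lambda>k. v $ k \<noteq> w $ k" _ e] by metis
    then have "\<forall>j. e j < e k \<longrightarrow> v $ j = w $ j"
      by (meson not_less)
    then show ?thesis
      using k(1) unfolding lex_def by (metis linorder_neqE_nat)
  qed
  have trans: "lex u w" if "lex u v" "lex v w" for u v w
  proof -
    obtain k l where k: "u $ k < v $ k" "\<forall>j. e j < e k \<longrightarrow> u $ j = v $ j"
      and l: "v $ l < w $ l" "\<forall>j. e j < e l \<longrightarrow> v $ j = w $ j"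
      using \<open>lex u v\<close> \<open>lex v w\<close> unfolding lex_def by blast
    consider "e k < e l" | "e l < e k" | "k = l"
      using e by (metis injD linorder_neqE_nat)
    then show ?thesis
    proof cases
      case 1
      then show ?thesis
        using k l unfolding lex_def by (intro exI[of _ k]) auto
    next
      case 2
      then show ?thesis
        using k l unfolding lex_def by (intro exI[of _ l]) auto
    next
      case 3
      then show ?thesis
        using k l unfolding lex_def by (intro exI[of _ k]) auto
    qed
  qed
  have zero: "lex 0 v" if "v \<noteq> 0" for v
    using total[OF that] by (auto simp: lex_def)
  have irrefl: "\<not> lex v v" and shift: "lex v w \<Longrightarrow> lex (v + u) (w + u)" for u v w
    by (auto simp: lex_def)
  have "monomial_order lex"
    unfolding monomial_order_def
    using total trans zero irrefl shift by (auto intro!: irreflpI transpI totalpI)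
  then show ?thesis
    by blast
qed

text \<open>If instead \<open>x' \<prec> y'\<close>, adding \<open>x\<close> gives \<open>f \<prec> x + y'\<close>, whereas adding \<open>y'\<close> to \<open>x \<prec> y\<close> gives
  \<open>x + y' \<prec> f\<close>.\<close>

lemma monomial_order_reflect:
  assumes "monomial_order prec" and "x + x' = f" and "y + y' = f" and "prec x y"
  shows "prec y' x'"
proof (rule ccontr)
  assume not: "\<not> prec y' x'"
  have irrefl: "\<not> prec v v" and trans: "prec u v \<Longrightarrow> prec v w \<Longrightarrow> prec u w"
    and total: "v \<noteq> w \<Longrightarrow> prec v w \<or> prec w v" and shift: "prec v w \<Longrightarrow> prec (v + u) (w + u)"
    for u v w
    using assms(1) unfolding monomial_order_def
    by (blast dest: irreflpD transpD totalpD)+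
  have "x' \<noteq> y'"
    using assms irrefl by (metis add_right_imp_eq)
  then have "prec x' y'"
    using not total by blast
  then have "prec (x' + x) (y' + x)"
    by (rule shift)
  moreover have "prec (x + y') (y + y')"
    using \<open>prec x y\<close> by (rule shift)
  ultimately show False
    using assms(2,3) trans irrefl by (metis add.commute)
qed

text \<open>The position of an element in an increasing listing is determined by the number of elements
  below it, or equally by the number of elements above it.\<close>

lemma
  assumes "irreflp prec" and "transp prec" and "increasing_listing prec A t x" and "i \<in> {1..<t}"
  shows card_below_listed: "card {b \<in> A. prec b (x i)} = i - 1"
    and card_above_listed: "card {b \<in> A. prec (x i) b} = t - 1 - i"
proof -
  have A: "A = x ` {1..<t}"
    using assms(3) by (simp add: increasing_listing_def)
  have inc: "prec (x j) (x k)" if "j \<in> {1..<t}" "k \<in> {1..<t}" "j < k" for j k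
    using assms(3) that unfolding increasing_listing_def by blast
  have inj: "inj_on x {1..<t}"
    using inc assms(1) by (intro linorder_inj_onI) (auto simp: irreflp_def, metis)
  have iff: "prec (x j) (x k) \<longleftrightarrow> j < k" if "j \<in> {1..<t}" "k \<in> {1..<t}" for j k
    using inc that assms(1,2) by (metis irreflpD linorder_neqE_nat transpD)
  have "{b \<in> A. prec b (x i)} = x ` {1..<i}"
    unfolding A using iff[OF _ assms(4)] assms(4) by (auto simp: image_iff)
  moreover have "inj_on x {1..<i}"
    using inj by (rule inj_on_subset) (use assms(4) in auto)
  ultimately show "card {b \<in> A. prec b (x i)} = i - 1"
    by (simp add: card_image)
  have "{b \<in> A. prec (x i) b} = x ` {Suc i..<t}"
    unfolding A using iff[OF assms(4)] assms(4) by (auto simp: image_iff)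
  moreover have "inj_on x {Suc i..<t}"
    using inj by (rule inj_on_subset) auto
  ultimately show "card {b \<in> A. prec (x i) b} = t - 1 - i"
    by (simp add: card_image)
qed

text \<open>The listing inverts the rank function \<open>a \<mapsto> |{b \<in> A. b \<prec> a}| + 1\<close>.\<close>

lemma increasing_listing_exists:
  assumes "irreflp prec" and "transp prec" and "totalp prec" and "finite A" and "t = Suc (card A)"
  shows "\<exists>x. increasing_listing prec A t x"
proof -
  define r where "r a = Suc (card {b \<in> A. prec b a})" for a
  have mono: "r a < r b" if "a \<in> A" "b \<in> A" "prec a b" for a b
  proof -
    have "{c \<in> A. prec c a} \<subset> {c \<in> A. prec c b}"
      using that assms(1,2) by (auto dest: irreflpD transpD)
    then show ?thesis
      using \<open>finite A\<close> by (simp add: r_def psubset_card_mono)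
  qed
  then have inj: "inj_on r A"
    using \<open>totalp prec\<close> by (intro inj_onI) (metis less_irrefl totalpD)
  have "r a \<in> {1..<t}" if "a \<in> A" for a
  proof -
    have "{b \<in> A. prec b a} \<subset> A"
      using that assms(1) by (auto dest: irreflpD)
    then show ?thesis
      using \<open>finite A\<close> assms(5) by (simp add: r_def psubset_card_mono)
  qed
  then have "r ` A = {1..<t}"
    using inj assms(5) by (intro card_subset_eq) (auto simp: card_image)
  then have bij: "bij_betw r A {1..<t}"
    using inj by (simp add: bij_betw_def)
  define x where "x = inv_into A r"
  have x: "x i \<in> A" "r (x i) = i" if "i \<in> {1..<t}" for i
    using that bij unfolding x_def
    by (auto simp: bij_betw_def inv_into_into f_inv_into_f)
  have "prec (x i) (x j)" if "i \<in> {1..<t}" "j \<in> {1..<t}" "i < j" for i j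
    using x[of i] x[of j] that mono[of "x j" "x i"] totalpD[OF \<open>totalp prec\<close>, of "x i" "x j"]
    by force
  moreover have "A = x ` {1..<t}"
    using bij_betw_inv_into[OF bij] by (simp add: x_def bij_betw_def)
  ultimately show ?thesis
    unfolding increasing_listing_def by blast
qed

text \<open>The reflection exchanges the elements below \<open>x i\<close> with those above \<open>f - x i\<close>, so comparing
  the two counts identifies \<open>f - x i\<close> as the element listed at position \<open>t - i\<close>.\<close>

lemma increasing_listing_antipodal:
  fixes f :: "nat ^ 'd"
  assumes "monomial_order prec" and "increasing_listing prec A t x" and "i \<in> {1..<t}"
    and reflect: "\<And>a. a \<in> A \<Longrightarrow> \<exists>a'\<in>A. a + a' = f"
  shows "x i + x (t - i) = f"
proof -
  have order: "irreflp prec" "transp prec"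
    using assms(1) by (auto simp: monomial_order_def)
  have A: "A = x ` {1..<t}"
    using assms(2) by (simp add: increasing_listing_def)
  obtain j where j: "j \<in> {1..<t}" "x i + x j = f"
    using reflect[of "x i"] assms(3) A by auto
  have inv: "f - a \<in> A \<and> a + (f - a) = f" if "a \<in> A" for a
    using reflect[OF that] by auto
  have "bij_betw (\<lambda>a. f - a) {b \<in> A. prec b (x i)} {b \<in> A. prec (x j) b}"
  proof (rule bij_betw_byWitness[where f' = "\<lambda>a. f - a"])
    show "\<forall>a\<in>{b \<in> A. prec b (x i)}. f - (f - a) = a"
      "\<forall>a\<in>{b \<in> A. prec (x j) b}. f - (f - a) = a"
      using inv by (metis (no_types, lifting) add_diff_cancel_right' mem_Collect_eq)+
    show "(\<lambda>a. f - a) ` {b \<in> A. prec b (x i)} \<subseteq> {b \<in> A. prec (x j) b}"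
      using inv j(2) monomial_order_reflect[OF assms(1)] by fastforce
    show "(\<lambda>a. f - a) ` {b \<in> A. prec (x j) b} \<subseteq> {b \<in> A. prec b (x i)}"
      using inv j(2) monomial_order_reflect[OF assms(1)] add.commute by fastforce
  qed
  then have "i - 1 = t - 1 - j"
    using card_below_listed[OF order assms(2,3)] card_above_listed[OF order assms(2) j(1)]
    by (simp add: bij_betw_same_card)
  then have "j = t - i"
    using j(1) assms(3) by auto
  then show ?thesis
    using j(2) by simp
qed

section \<open>Boxes of natural vectors\<close>

lemma vec_diff_add: "h \<le> f \<Longrightarrow> h + (f - h) = f" for h f :: "nat ^ 'd"
  by (simp add: vec_eq_iff less_eq_vec_def)

lemma vec_le_add: "h \<le> h + s" for h s :: "nat ^ 'd"
  by (simp add: less_eq_vec_def)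

lemma bij_betw_vec_nth_atMost:
  "bij_betw vec_nth {x. x \<le> f} (\<Pi>\<^sub>E i\<in>UNIV. {..f $ i})" for f :: "nat ^ 'd"
  by (rule bij_betw_byWitness[where f' = vec_lambda])
     (auto simp: less_eq_vec_def PiE_def Pi_def extensional_def)

lemma card_vec_atMost: "card {x. x \<le> f} = component_product (f + 1)" for f :: "nat ^ 'd"
  using bij_betw_same_card[OF bij_betw_vec_nth_atMost[of f]]
  by (simp add: card_PiE component_product_def)

lemma finite_vec_atMost: "finite {x. x \<le> f}" for f :: "nat ^ 'd"
  using bij_betw_finite[OF bij_betw_vec_nth_atMost[of f]] by (simp add: finite_PiE)

lemma component_product_mono:
  "h \<le> f \<Longrightarrow> component_product (h + 1) \<le> component_product (f + 1)"
  by (auto simp: component_product_def less_eq_vec_def intro!: prod_mono)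

lemma emb_diff: "h \<le> f \<Longrightarrow> emb f - emb h = emb (f - h)"
  by (simp add: emb_def vec_eq_iff less_eq_vec_def of_nat_diff)

lemma inj_emb: "inj emb"
  by (auto simp: inj_def emb_def vec_eq_iff)

lemma range_emb: "range emb = {x. 0 \<le> x}"
proof
  show "{x. 0 \<le> x} \<subseteq> range emb"
  proof
    fix x :: "int ^ 'd"
    assume "x \<in> {x. 0 \<le> x}"
    then have "x = emb (\<chi> i. nat (x $ i))"
      by (simp add: emb_def vec_eq_iff less_eq_vec_def)
    then show "x \<in> range emb" by blast
  qed
qed (auto simp: emb_def less_eq_vec_def)

section \<open>Gaps of a Frobenius generalized numerical semigroup\<close>

context
  fixes S :: "(nat ^ 'd) set" and f :: "nat ^ 'd"
  assumes frobenius: "is_frobenius_element S f"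
begin

lemma zero_in_semigroup: "0 \<in> S"
  and add_in_semigroup: "x \<in> S \<Longrightarrow> y \<in> S \<Longrightarrow> x + y \<in> S"
  and finite_gaps: "finite (gaps S)"
  and frobenius_gap: "f \<in> gaps S"
  using frobenius
  by (auto simp: is_frobenius_element_def frobenius_gns_def gns_def gaps_def is_maximal_in_def)

lemma gap_le_frobenius:
  assumes "h \<in> gaps S"
  shows "h \<le> f"
proof -
  obtain m where m: "m \<in> gaps S" "h \<le> m" "\<forall>b\<in>gaps S. m \<le> b \<longrightarrow> m = b"
    using finite_has_maximal2[OF finite_gaps assms] by blast
  then have "is_maximal_in (gaps S) m"
    by (auto simp: is_maximal_in_def)
  then have "m = f"
    using frobenius unfolding is_frobenius_element_def frobenius_gns_def by blast
  then show ?thesis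
    using m(2) by simp
qed

text \<open>A maximal gap among the translates of \<open>h\<close> by elements of \<open>S\<close> is pseudo-Frobenius.\<close>

lemma pseudo_frobenius_above_gap:
  assumes "h \<in> gaps S"
  shows "\<exists>s\<in>S. h + s \<in> pseudo_frobenius S"
proof -
  let ?T = "{g \<in> gaps S. \<exists>s\<in>S. g = h + s}"
  have "finite ?T" "h \<in> ?T"
    using finite_gaps assms zero_in_semigroup by (auto intro: bexI[of _ 0])
  then obtain m where m: "m \<in> ?T" "\<forall>b\<in>?T. m \<le> b \<longrightarrow> m = b"
    using finite_has_maximal2[of ?T h] by blast
  then obtain s where s: "s \<in> S" "m = h + s" "m \<in> gaps S"
    by blast
  have "m + u \<in> S" if "u \<in> S - {0}" for u
  proof (rule ccontr)
    assume "m + u \<notin> S"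
    then have "m + u \<in> ?T"
      using s that add_in_semigroup[of s u] by (auto simp: gaps_def add.assoc)
    then have "m = m + u"
      using m(2) vec_le_add by blast
    then show False
      using that by simp
  qed
  then have "m \<in> pseudo_frobenius S"
    using s(3) by (simp add: pseudo_frobenius_def)
  then show ?thesis
    using s by blast
qed

lemma pseudo_frobenius_subset_gaps: "pseudo_frobenius S \<subseteq> gaps S"
  by (auto simp: pseudo_frobenius_def)

lemma finite_pseudo_frobenius: "finite (pseudo_frobenius S)"
  using pseudo_frobenius_subset_gaps finite_gaps by (rule finite_subset)

lemma frobenius_pseudo_frobenius: "f \<in> pseudo_frobenius S"
proof -
  have "f + s \<in> S" if "s \<noteq> 0" for s
  proof (rule ccontr)
    assume "f + s \<notin> S"
    then have "f + s \<le> f"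
      by (intro gap_le_frobenius) (simp add: gaps_def)
    then have "f + s = f"
      using vec_le_add by (rule antisym)
    then show False
      using that by simp
  qed
  then show ?thesis
    using frobenius_gap by (simp add: pseudo_frobenius_def)
qed

lemma L_set_subset_gaps: "L_set S f \<subseteq> gaps S"
  by (auto simp: L_set_def)

lemma frobenius_notin_L_set: "f \<notin> L_set S f"
  using zero_in_semigroup by (auto simp: L_set_def gaps_def)

lemma gap_complement_cases:
  assumes "h \<in> gaps S"
  obtains "f - h \<in> S" "h \<notin> L_set S f" | "f - h \<in> L_set S f" "h \<in> L_set S f"
proof (cases "f - h \<in> S")
  case True
  then have "h \<notin> L_set S f"
    by (auto simp: L_set_def gaps_def)
  then show ?thesis
    using that(1) True by blast
next
  case False
  have "h + (f - h) = f"
    using gap_le_frobenius[OF assms] by (rule vec_diff_add)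
  moreover from this have "(f - h) + h = f"
    by (metis add.commute)
  moreover have "f - h \<in> gaps S"
    using False by (simp add: gaps_def)
  ultimately have "f - h \<in> L_set S f" "h \<in> L_set S f"
    using assms unfolding L_set_def by blast+
  then show ?thesis
    by (rule that(2))
qed

lemma pseudo_frobenius_subset_L_set: "pseudo_frobenius S - {f} \<subseteq> L_set S f"
proof
  fix h
  assume h: "h \<in> pseudo_frobenius S - {f}"
  then have gap: "h \<in> gaps S"
    using pseudo_frobenius_subset_gaps by blast
  then have sum: "h + (f - h) = f"
    by (intro vec_diff_add gap_le_frobenius)
  show "h \<in> L_set S f"
    using gap
  proof (cases rule: gap_complement_cases)
    case 1
    moreover have "f - h \<noteq> 0"
      using h sum by auto
    ultimately have "h + (f - h) \<in> S"
      using h unfolding pseudo_frobenius_def by blast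
    then show ?thesis
      using sum frobenius_gap by (simp add: gaps_def)
  qed
qed

text \<open>The box splits into \<open>H\<close> and its part in \<open>S\<close>, and the latter is reflected onto \<open>H - L\<close>.\<close>

lemma component_product_plus_card_L:
  "component_product (f + 1) + card (L_set S f) = 2 * genus S"
proof -
  let ?B = "{x. x \<le> f}"
  have "bij_betw (\<lambda>x. f - x) (?B - gaps S) (gaps S - L_set S f)"
  proof (rule bij_betw_byWitness[where f' = "\<lambda>x. f - x"])
    show "\<forall>x\<in>?B - gaps S. f - (f - x) = x" "\<forall>x\<in>gaps S - L_set S f. f - (f - x) = x"
      using gap_le_frobenius by (auto simp: vec_eq_iff less_eq_vec_def)
    show "(\<lambda>x. f - x) ` (?B - gaps S) \<subseteq> gaps S - L_set S f"
    proof clarify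
      fix x
      assume x: "x \<le> f" "x \<notin> gaps S"
      then have "f = x + (f - x)"
        by (simp add: vec_diff_add)
      then have gap: "f - x \<in> gaps S"
        using x(2) frobenius_gap add_in_semigroup[of x "f - x"] by (auto simp: gaps_def)
      have "f - (f - x) \<notin> L_set S f"
        using x L_set_subset_gaps \<open>f = x + (f - x)\<close> by (metis add_diff_cancel_right' subsetD)
      with gap show "f - x \<in> gaps S - L_set S f"
        by (metis DiffI gap_complement_cases)
    qed
    show "(\<lambda>x. f - x) ` (gaps S - L_set S f) \<subseteq> ?B - gaps S"
    proof clarify
      fix x
      assume x: "x \<in> gaps S" "x \<notin> L_set S f"
      then have "f - x \<in> S"
        by (cases rule: gap_complement_cases) auto
      then show "f - x \<in> ?B - gaps S"
        by (simp add: gaps_def less_eq_vec_def)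
    qed
  qed
  then have "card (?B - gaps S) = card (gaps S - L_set S f)"
    by (rule bij_betw_same_card)
  moreover have "card (A - G) + card G = card A" if "G \<subseteq> A" "finite A" for A G :: "(nat ^ 'd) set"
    using that by (simp add: card_Diff_subset card_mono finite_subset)
  from this[of "gaps S" ?B] this[of "L_set S f" "gaps S"]
  have "card (?B - gaps S) + card (gaps S) = card ?B"
    "card (gaps S - L_set S f) + card (L_set S f) = card (gaps S)"
    using gap_le_frobenius finite_vec_atMost L_set_subset_gaps finite_gaps by auto
  ultimately show ?thesis
    by (simp add: card_vec_atMost genus_def)
qed

lemma gns_type_eq: "gns_type S = Suc (card (pseudo_frobenius S - {f}))"
  unfolding gns_type_def
  using finite_pseudo_frobenius frobenius_pseudo_frobenius by (rule card.remove)

section \<open>The equivalent conditions\<close>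

lemma L_set_subset_iff_eq:
  "L_set S f \<subseteq> pseudo_frobenius S \<longleftrightarrow> pseudo_frobenius S - {f} = L_set S f"
  using pseudo_frobenius_subset_L_set frobenius_notin_L_set by blast

text \<open>Any \<open>h\<close> witnessing almost symmetry satisfies
  \<open>|h + 1|\<^sub>\<times> \<le> |f + 1|\<^sub>\<times> \<le> 2 g + 1 - t = |h + 1|\<^sub>\<times>\<close>, so the witness may be taken to be \<open>f\<close>.\<close>

lemma almost_symmetric_iff_L_set_subset:
  "almost_symmetric S \<longleftrightarrow> L_set S f \<subseteq> pseudo_frobenius S"
proof -
  let ?c = "\<lambda>h :: nat ^ 'd. component_product (h + 1)"
  have fin: "finite (L_set S f)"
    using L_set_subset_gaps finite_gaps by (rule finite_subset)
  have count: "2 * int (genus S) + 1 - int (gns_type S)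
      = int (?c f) + (int (card (L_set S f)) - int (card (pseudo_frobenius S - {f})))"
    using component_product_plus_card_L gns_type_eq by linarith
  have le: "card (pseudo_frobenius S - {f}) \<le> card (L_set S f)"
    using fin pseudo_frobenius_subset_L_set by (rule card_mono)
  have "almost_symmetric S \<longleftrightarrow> card (pseudo_frobenius S - {f}) = card (L_set S f)"
  proof
    assume "almost_symmetric S"
    then obtain h where h: "h \<in> gaps S"
      "2 * int (genus S) + 1 - int (gns_type S) = int (?c h)"
      by (auto simp: almost_symmetric_def)
    then show "card (pseudo_frobenius S - {f}) = card (L_set S f)"
      using count le component_product_mono[OF gap_le_frobenius[OF h(1)]] by linarith
  next
    assume "card (pseudo_frobenius S - {f}) = card (L_set S f)"
    then show "almost_symmetric S"
      using count frobenius_gap unfolding almost_symmetric_def by auto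
  qed
  also have "\<dots> \<longleftrightarrow> pseudo_frobenius S - {f} = L_set S f"
    by (metis card_subset_eq[OF fin pseudo_frobenius_subset_L_set])
  finally show ?thesis
    by (simp add: L_set_subset_iff_eq)
qed

lemma L_set_subset_iff_complements:
  "L_set S f \<subseteq> pseudo_frobenius S \<longleftrightarrow>
    (\<forall>h\<in>gaps S. f - h \<in> S \<or> f - h \<in> pseudo_frobenius S)"
proof
  assume sub: "L_set S f \<subseteq> pseudo_frobenius S"
  show "\<forall>h\<in>gaps S. f - h \<in> S \<or> f - h \<in> pseudo_frobenius S"
  proof
    fix h
    assume "h \<in> gaps S"
    then show "f - h \<in> S \<or> f - h \<in> pseudo_frobenius S"
      using sub by (cases rule: gap_complement_cases) auto
  qed
next
  assume compl: "\<forall>h\<in>gaps S. f - h \<in> S \<or> f - h \<in> pseudo_frobenius S"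
  show "L_set S f \<subseteq> pseudo_frobenius S"
  proof
    fix h
    assume "h \<in> L_set S f"
    then obtain h' where h': "h \<in> gaps S" "h' \<in> gaps S" "h + h' = f"
      by (auto simp: L_set_def)
    then have "f - h' = h"
      by auto
    then show "h \<in> pseudo_frobenius S"
      using compl h' by (auto simp: gaps_def)
  qed
qed

lemma emb_complement_iff:
  assumes "h \<in> gaps S"
  shows "emb f - emb h \<in> emb ` A \<longleftrightarrow> f - h \<in> A"
  using emb_diff[OF gap_le_frobenius[OF assms]] by (simp add: inj_image_mem_iff[OF inj_emb])

text \<open>In a negative coordinate of \<open>h\<close> the vector \<open>f - h\<close> exceeds \<open>f\<close>, and all gaps lie below \<open>f\<close>.\<close>

lemma complement_of_nonnatural:
  assumes "h \<le> emb f" and "h \<notin> range emb"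
  shows "emb f - h \<in> emb ` S"
proof -
  have "emb f - h \<in> range emb"
    using assms(1) unfolding range_emb by (simp add: less_eq_vec_def)
  then obtain g where g: "emb f - h = emb g"
    by blast
  have "\<not> g \<le> f"
  proof
    assume "g \<le> f"
    then have "h = emb (f - g)"
      using emb_diff[of g f] g by (simp add: algebra_simps)
    then show False
      using assms(2) by blast
  qed
  then have "g \<in> S"
    using gap_le_frobenius by (auto simp: gaps_def)
  then show ?thesis
    using g by simp
qed

lemma Z_set_complements_iff:
  "(\<forall>h \<in> Z_set f - emb ` S. emb f - h \<in> emb ` S \<or> emb f - h \<in> emb ` pseudo_frobenius S) \<longleftrightarrow>
    (\<forall>h \<in> gaps S. emb f - emb h \<in> emb ` S \<or> emb f - emb h \<in> emb ` pseudo_frobenius S)"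
proof -
  have "emb h \<in> Z_set f - emb ` S" if "h \<in> gaps S" for h
    using that by (simp add: Z_set_def gaps_def inj_image_mem_iff[OF inj_emb])
  moreover have "emb f - h \<in> emb ` S \<or> h \<in> emb ` gaps S" if "h \<in> Z_set f - emb ` S" for h
    using that complement_of_nonnatural[of h] by (auto simp: Z_set_def gaps_def)
  ultimately show ?thesis
    by blast
qed

text \<open>If \<open>h\<close> and \<open>f - h\<close> are gaps and \<open>h + s\<close> is pseudo-Frobenius with \<open>s \<in> S\<close>, then
  \<open>h + s \<noteq> f\<close> because \<open>f - h \<notin> S\<close>, and so \<open>f - (h + s)\<close> is pseudo-Frobenius by invariance. Its sum
  with \<open>s\<close> is the gap \<open>f - h\<close>, which forces \<open>s = 0\<close>.\<close>

lemma L_set_subset_if_reflection_invariant: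
  assumes reflect: "\<And>p. p \<in> pseudo_frobenius S - {f} \<Longrightarrow> \<exists>p'\<in>pseudo_frobenius S. p + p' = f"
  shows "L_set S f \<subseteq> pseudo_frobenius S"
proof
  fix h
  assume "h \<in> L_set S f"
  then obtain h' where h': "h \<in> gaps S" "h' \<in> gaps S" "h + h' = f"
    by (auto simp: L_set_def)
  obtain s where s: "s \<in> S" "h + s \<in> pseudo_frobenius S"
    using pseudo_frobenius_above_gap[OF h'(1)] by blast
  have "h + s \<noteq> f"
    using h' s(1) by (auto simp: gaps_def)
  then obtain p' where p': "p' \<in> pseudo_frobenius S" "h + s + p' = f"
    using reflect s(2) by blast
  then have "h' = p' + s"
    using h'(3) by (metis add.assoc add.commute add_left_imp_eq)
  then have "s = 0"
    using h'(2) p'(1) s(1) unfolding pseudo_frobenius_def gaps_def by blast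
  then show "h \<in> pseudo_frobenius S"
    using s(2) by simp
qed

lemma antipodal_listing_if_L_set_subset:
  assumes "L_set S f \<subseteq> pseudo_frobenius S" and "monomial_order prec"
    and "increasing_listing prec (pseudo_frobenius S - {f}) t x" and "i \<in> {1..<t}"
  shows "x i + x (t - i) = f"
proof (rule increasing_listing_antipodal[OF assms(2,3,4)])
  fix a
  assume "a \<in> pseudo_frobenius S - {f}"
  then show "\<exists>a'\<in>pseudo_frobenius S - {f}. a + a' = f"
    using assms(1) unfolding L_set_subset_iff_eq
    by (auto simp: L_set_def add.commute)
qed

lemma L_set_subset_if_antipodal_listing:
  assumes order: "monomial_order prec"
    and antipodal: "\<And>x i. increasing_listing prec (pseudo_frobenius S - {f}) (gns_type S) x \<Longrightarrow>
      i \<in> {1..<gns_type S} \<Longrightarrow> x i + x (gns_type S - i) = f"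
  shows "L_set S f \<subseteq> pseudo_frobenius S"
proof (rule L_set_subset_if_reflection_invariant)
  let ?t = "gns_type S"
  obtain x where x: "increasing_listing prec (pseudo_frobenius S - {f}) ?t x"
    using increasing_listing_exists[of prec "pseudo_frobenius S - {f}" ?t] order
      finite_pseudo_frobenius gns_type_eq by (auto simp: monomial_order_def)
  then have image: "pseudo_frobenius S - {f} = x ` {1..<?t}"
    by (simp add: increasing_listing_def)
  fix p
  assume "p \<in> pseudo_frobenius S - {f}"
  then obtain i where i: "i \<in> {1..<?t}" "p = x i"
    using image by auto
  then have "?t - i \<in> {1..<?t}"
    by auto
  then have "x (?t - i) \<in> pseudo_frobenius S"
    using image by blast
  then show "\<exists>p'\<in>pseudo_frobenius S. p + p' = f"
    using antipodal[OF x i(1)] i(2) by blast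
qed

end

theorem proposition3p3:
  fixes S :: "(nat ^ 'd) set" and f :: "nat ^ 'd" and t :: nat
  assumes "frobenius_gns S" and "is_frobenius_element S f" and "t = gns_type S"
  shows "(almost_symmetric S \<longleftrightarrow> L_set S f \<subseteq> pseudo_frobenius S)
    \<and> (almost_symmetric S \<longleftrightarrow> pseudo_frobenius S = L_set S f \<union> {f})
    \<and> (almost_symmetric S \<longleftrightarrow>
         (\<forall>h \<in> Z_set f - emb ` S.
            emb f - h \<in> emb ` S \<or> emb f - h \<in> emb ` pseudo_frobenius S))
    \<and> (almost_symmetric S \<longleftrightarrow>
         (\<forall>h \<in> gaps S.
            emb f - emb h \<in> emb ` S \<or> emb f - emb h \<in> emb ` pseudo_frobenius S))
    \<and> (almost_symmetric S \<longleftrightarrow>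
         (\<forall>prec. monomial_order prec \<longrightarrow>
            (\<forall>x. increasing_listing prec (pseudo_frobenius S - {f}) t x \<longrightarrow>
               (\<forall>i\<in>{1..<t}. x i + x (t - i) = f))))
    \<and> (almost_symmetric S \<longleftrightarrow>
         (\<exists>prec. monomial_order prec \<and>
            (\<forall>x. increasing_listing prec (pseudo_frobenius S - {f}) t x \<longrightarrow>
               (\<forall>i\<in>{1..<t}. x i + x (t - i) = f))))"
proof -
  note frobenius = assms(2)
  note sym = almost_symmetric_iff_L_set_subset[OF frobenius]
  have eq: "L_set S f \<subseteq> pseudo_frobenius S \<longleftrightarrow> pseudo_frobenius S = L_set S f \<union> {f}"
    using L_set_subset_iff_eq[OF frobenius] frobenius_pseudo_frobenius[OF frobenius] by blast
  have gaps: "L_set S f \<subseteq> pseudo_frobenius S \<longleftrightarrow>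
      (\<forall>h \<in> gaps S. emb f - emb h \<in> emb ` S \<or> emb f - emb h \<in> emb ` pseudo_frobenius S)"
    using L_set_subset_iff_complements[OF frobenius] emb_complement_iff[OF frobenius] by simp
  note all = antipodal_listing_if_L_set_subset[OF frobenius]
  note ex = L_set_subset_if_antipodal_listing[OF frobenius, folded assms(3)]
  show ?thesis
    unfolding sym Z_set_complements_iff[OF frobenius] gaps[symmetric] eq[symmetric]
    using all ex monomial_order_exists[where 'd = 'd] by (intro conjI iffI refl) (blast | metis)+
qed

end
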